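(* Let $\mu\in\mathcal V$, let $\overline\mu\in\overline{\mathcal V}$ be a fixed extension of $\mu$ to $\overline K[x]$, and let $\mathcal B^{\mathrm{opt}}=\mathcal B^{\mathrm{opt}}(\overline\mu)$ be the associated set of $\mu$-optimal balls. Then $\Psi(\mu)$ is the disjoint union $$\Psi(\mu)=\bigcup_{B\in\mathcal B^{\mathrm{opt}}}p_K\left(\operatorname{Opt}(B)\right).$$
   Context: $(K,v)$ is a valued field, $\overline K$ an algebraic closure of $K$, and $v$ also denotes a fixed extension of $v$ to $\overline K$. Put $\Gamma=v\overline K$ and fix an embedding $\Gamma\hookrightarrow\Lambda$ into a divisible (totally) ordered abelian group $\Lambda$. $\mathcal V$ is the set of all $\Lambda$-valued valuations on $K(x)$ whose restriction to $K$ is $v$, identified with valuations $\mu:K[x]\to\Lambda\cup\{\infty\}$ with $\mu^{-1}(\infty)=\{0\}$ and $\mu_{\mid K}=v$; $\overline{\mathcal V}$ is the set of $\Lambda$-valued valuations on $\overline K(x)$ whose restriction to $\overline K$ is $v$. Both are partially ordered by $\mu\le\eta$ iff $\mu(f)\le\eta(f)$ for all polynomials $f$. An extension of $\mu\in\mathcal V$ is $\overline\mu\in\overline{\mathcal V}$ with $\overline\mu_{\mid K[x]}=\mu$. For $(a,\delta)\in\overline K\times\Lambda$: $B(a,\delta)=\{b\in\overline K\mid v(b-a)\ge\delta\}$, and $v_{a,\delta}\in\overline{\mathcal V}$ is given by $v_{a,\delta}\left(\sum_k a_k(x-a)^k\right)=\min_k\{v(a_k)+k\delta\}$. $\mathbb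 B$ is the set of all balls $B(a,\delta)$, $(a,\delta)\in\overline K\times\Lambda$. For $c\in\overline K$, $p_K(c)\in K[x]$ is its minimal polynomial over $K$, and $\deg_K c=\deg p_K(c)$. For $S\subseteq\overline K$: $p_K(S)=\{p_K(c)\mid c\in S\}$, $\deg_K S=\min\{\deg_K c\mid c\in S\}$, $\operatorname{Min}_K S=\{c\in S\mid\deg_K c=\deg_K S\}$. Abstract key polynomials: let $\partial_s$ ($s\ge1$) be the Hasse–Schmidt derivatives on $K[x]$, defined by $f(x+y)=\sum_{s\ge0}(\partial_s f)y^s$. For non-constant $f\in K[x]$, $\epsilon_\mu(f)=\max\{(\mu(f)-\mu(\partial_s f))/s\mid s\ge1,\ \partial_sf\neq0\}\in\Lambda$. A monic non-constant $Q\in K[x]$ is an abstract key polynomial for $\mu$ if for every non-constant $f\in K[x]$, $\deg f<\deg Q$ implies $\epsilon_\mu(f)<\epsilon_\mu(Q)$. $\Psi(\mu)$ is the set of all abstract key polynomials for $\mu$. A valuation $\mu\in\mathcal V$ (value group $\Gamma_\mu$, residue field $k_\mu$) is valuation-transcendental if $\Gamma_\mu/vK$ is not torsion or $k_\mu$ is transcendental over the residue field $Kv$; otherwise it is valuation-algebraic. A family $\{\mu_i\}_{i\in I}$ is increasing if $I$ is totally ordered and $\mu_i<\mu_j$ for $i<j$; $\mu$ is its stable limit if every polynomial $f$ satisfies $\mu_i(f)=\mu(f)$ for all sufficiently large $i$. The chain $\mathcal B(\overline\mu)$: if $\mu$ is valuation-transcendental, then $\overline\mu=v_{a,\delta}$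 for some $(a,\delta)\in\overline K\times\Lambda$, and $\mathcal B(\overline\mu)=\{B\in\mathbb B\mid B\supseteq B(a,\delta)\}$. If $\mu$ is valuation-algebraic, then $\overline\mu$ is the stable limit of an increasing family $\{\overline\mu_i=v_{a_i,\delta_i}\}_{i\in I}$ in $\overline{\mathcal V}$ extending (member by member) an increasing family $\{\mu_i\}_{i\in I}$ in $\mathcal V$ with stable limit $\mu$; fix such a family, put $B_i=B(a_i,\delta_i)$, and let $\mathcal B(\overline\mu)=\{B\in\mathbb B\mid B\supseteq B_i\text{ for some }i\in I\}$. A ball $B=B(b,\gamma)\in\mathcal B(\overline\mu)$ is $\mu$-optimal if there exists $c\in\operatorname{Min}_K B$ such that $\epsilon_\mu(p_K(c))=\gamma$ (as a set, $B$ is $\mu$-optimal if it has a presentation $B(b,\gamma)$ with this property, and $\gamma$ is then taken as its radius). $\mathcal B^{\mathrm{opt}}(\overline\mu)$ is the set of $\mu$-optimal balls in $\mathcal B(\overline\mu)$. For a $\mu$-optimal ball $B=B(b,\gamma)$, $\operatorname{Opt}(B)=\{c\in\operatorname{Min}_K B\mid\epsilon_\mu(p_K(c))=\gamma\}$. *)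

theory Defs
  imports
    "HOL-Algebra.Algebraic_Closure_Type"
    "HOL-Library.Extended"
    "HOL-Library.Disjoint_Sets"
    "HOL-Computational_Algebra.Computational_Algebra"
begin

subsection \<open>Divisible ordered abelian groups\<close>

definition (in comm_monoid_add) nsmul :: "nat \<Rightarrow> 'a \<Rightarrow> 'a" where
  "nsmul n x = (\<Sum>i<n. x)"

class divisible_linordered_ab_group_add = linordered_ab_group_add +
  assumes divisible: "n > 0 \<Longrightarrow> \<exists>y. nsmul n y = x"

text \<open>Such groups are torsion-free, so for \<open>n > 0\<close> the quotient \<open>x / n\<close> is unique.\<close>

definition ndiv :: "'l::divisible_linordered_ab_group_add \<Rightarrow> nat \<Rightarrow> 'l" where
  "ndiv x n = (THE y. nsmul n y = x)"

subsection \<open>Valuations\<close>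

text \<open>
  \<open>\<Lambda> \<union> {\<infinity>}\<close> is rendered by \<open>'l extended\<close>, whose additional value \<open>Minf\<close> is excluded.
\<close>

definition is_valuation ::
  "('r::idom \<Rightarrow> 'l::linordered_ab_group_add extended) \<Rightarrow> bool" where
  "is_valuation w \<longleftrightarrow>
     (\<forall>x. w x \<noteq> Minf) \<and> (\<forall>x. w x = Pinf \<longleftrightarrow> x = 0) \<and>
     (\<forall>x y. w (x * y) = w x + w y) \<and> (\<forall>x y. min (w x) (w y) \<le> w (x + y))"

definition fin_part :: "'l extended \<Rightarrow> 'l" where
  "fin_part e = (THE l. e = Fin l)"

text \<open>
  Valuations on \<open>F(x)\<close> extending a valuation \<open>w\<close> of \<open>F\<close>, identified with their restrictions to
  \<open>F[x]\<close>. Their partial order is the pointwise order on functions.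
\<close>

definition poly_valuations ::
  "('f::field \<Rightarrow> 'l::linordered_ab_group_add extended) \<Rightarrow> ('f poly \<Rightarrow> 'l extended) set" where
  "poly_valuations w = {\<mu>. is_valuation \<mu> \<and> (\<forall>c. \<mu> [:c:] = w c)}"

text \<open>
  \<open>\<iota>\<close> exhibits the algebraically closed field \<open>'a\<close> as an algebraic closure of \<open>'k\<close>. A valuation \<open>v\<close>
  of \<open>'a\<close> then restricts to the valuation \<open>v \<circ> \<iota>\<close> of \<open>'k\<close>.
\<close>

definition is_alg_closure :: "('k::field \<Rightarrow> 'a::alg_closed_field) \<Rightarrow> bool" where
  "is_alg_closure \<iota> \<longleftrightarrow>
     \<iota> 1 = 1 \<and> (\<forall>x y. \<iota> (x + y) = \<iota> x + \<iota> y) \<and> (\<forall>x y. \<iota> (x * y) = \<iota> x * \<iota> y) \<and>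
     (\<forall>a. \<exists>p. p \<noteq> 0 \<and> poly (map_poly \<iota> p) a = 0)"

definition restrict_val ::
  "('k::field \<Rightarrow> 'a::field) \<Rightarrow> ('a poly \<Rightarrow> 'l extended) \<Rightarrow> 'k poly \<Rightarrow> 'l extended" where
  "restrict_val \<iota> w = (\<lambda>f. w (map_poly \<iota> f))"

subsection \<open>Balls and the associated valuations\<close>

definition vball ::
  "('a::field \<Rightarrow> 'l::linordered_ab_group_add extended) \<Rightarrow> 'a \<Rightarrow> 'l \<Rightarrow> 'a set" where
  "vball v a \<delta> = {b. Fin \<delta> \<le> v (b - a)}"

definition all_balls ::
  "('a::field \<Rightarrow> 'l::linordered_ab_group_add extended) \<Rightarrow> 'a set set" where
  "all_balls v = {B. \<exists>a \<delta>. B = vball v a \<delta>}"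

text \<open>
  The coefficients of the expansion of \<open>f\<close> in powers of \<open>x - a\<close> are those of \<open>f(x + a)\<close>.
\<close>

definition ball_val ::
  "('a::field \<Rightarrow> 'l::linordered_ab_group_add extended) \<Rightarrow> 'a \<Rightarrow> 'l \<Rightarrow> 'a poly \<Rightarrow> 'l extended" where
  "ball_val v a \<delta> f =
     Min ((\<lambda>k. v (Polynomial.coeff (pcompose f [:a, 1:]) k) + Fin (nsmul k \<delta>))
            ` {..Polynomial.degree f})"

subsection \<open>Minimal polynomials and degrees\<close>

definition min_poly :: "('k::field \<Rightarrow> 'a::field) \<Rightarrow> 'a \<Rightarrow> 'k poly" where
  "min_poly \<iota> c =
     (THE p. Polynomial.lead_coeff p = 1 \<and> poly (map_poly \<iota> p) c = 0 \<and>
        (\<forall>q. q \<noteq> 0 \<and> poly (map_poly \<iota> q) c = 0 \<longrightarrow> Polynomial.degree p \<le> Polynomial.degree q))"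

definition degK :: "('k::field \<Rightarrow> 'a::field) \<Rightarrow> 'a \<Rightarrow> nat" where
  "degK \<iota> c = Polynomial.degree (min_poly \<iota> c)"

definition degK_set :: "('k::field \<Rightarrow> 'a::field) \<Rightarrow> 'a set \<Rightarrow> nat" where
  "degK_set \<iota> S = (LEAST n. \<exists>c\<in>S. n = degK \<iota> c)"

definition MinK :: "('k::field \<Rightarrow> 'a::field) \<Rightarrow> 'a set \<Rightarrow> 'a set" where
  "MinK \<iota> S = {c \<in> S. degK \<iota> c = degK_set \<iota> S}"

subsection \<open>Abstract key polynomials\<close>

text \<open>
  With coefficients embedded as constants, \<open>f(y)\<close> is a polynomial over \<open>K[x]\<close>; substituting
  \<open>x + y\<close> for \<open>y\<close> and taking the coefficient of \<open>y\<^sup>s\<close> gives the Hasse-Schmidt derivative.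
\<close>

definition hasse_deriv :: "nat \<Rightarrow> 'k::field poly \<Rightarrow> 'k poly" where
  "hasse_deriv s f =
     Polynomial.coeff (pcompose (map_poly (\<lambda>c. [:c:]) f) [:[:0, 1:], 1:]) s"

definition eps ::
  "('k::field poly \<Rightarrow> 'l::divisible_linordered_ab_group_add extended) \<Rightarrow> 'k poly \<Rightarrow> 'l" where
  "eps \<mu> f =
     Max {ndiv (fin_part (\<mu> f) - fin_part (\<mu> (hasse_deriv s f))) s
          | s. s \<ge> 1 \<and> hasse_deriv s f \<noteq> 0}"

definition abstract_key_polys ::
  "('k::field poly \<Rightarrow> 'l::divisible_linordered_ab_group_add extended) \<Rightarrow> 'k poly set" where
  "abstract_key_polys \<mu> =
     {Q. Polynomial.lead_coeff Q = 1 \<and> Polynomial.degree Q > 0 \<and>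
         (\<forall>f. Polynomial.degree f > 0 \<and> Polynomial.degree f < Polynomial.degree Q
                \<longrightarrow> eps \<mu> f < eps \<mu> Q)}"

subsection \<open>Valuation-transcendental valuations\<close>

text \<open>The extension of a valuation from \<open>K[x]\<close> to \<open>K(x)\<close> by \<open>\<mu> (f / g) = \<mu> f - \<mu> g\<close>.\<close>

definition fract_val ::
  "('r::idom \<Rightarrow> 'l::linordered_ab_group_add extended) \<Rightarrow> 'r fract \<Rightarrow> 'l extended" where
  "fract_val \<mu> q = (THE e. \<forall>f g. g \<noteq> 0 \<and> q = Fract f g \<longrightarrow> e + \<mu> g = \<mu> f)"

definition value_group :: "('f::field \<Rightarrow> 'l extended) \<Rightarrow> 'l set" where
  "value_group w = {l. \<exists>x. x \<noteq> 0 \<and> w x = Fin l}"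

definition valuation_ring ::
  "('f::field \<Rightarrow> 'l::linordered_ab_group_add extended) \<Rightarrow> 'f ring" where
  "valuation_ring w = ring_of_type_algebra \<lparr> carrier := {x. 0 \<le> w x} \<rparr>"

definition valuation_ideal ::
  "('f::field \<Rightarrow> 'l::linordered_ab_group_add extended) \<Rightarrow> 'f set" where
  "valuation_ideal w = {x. 0 < w x}"

definition residue_field ::
  "('f::field \<Rightarrow> 'l::linordered_ab_group_add extended) \<Rightarrow> 'f set ring" where
  "residue_field w = valuation_ring w Quot valuation_ideal w"

text \<open>
  The image of \<open>Kv\<close> under its canonical embedding into the residue field \<open>k\<^sub>\<mu>\<close> of \<open>K(x)\<close>.
\<close>

definition base_residue_field ::
  "('k::field \<Rightarrow> 'l::linordered_ab_group_add extended) \<Rightarrow> ('k poly \<Rightarrow> 'l extended) \<Rightarrow>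
   'k poly fract set set" where
  "base_residue_field w \<mu> =
     (\<lambda>c. valuation_ideal (fract_val \<mu>) +>\<^bsub>valuation_ring (fract_val \<mu>)\<^esub> Fract [:c:] 1)
       ` {c. 0 \<le> w c}"

definition valuation_transcendental ::
  "('k::field \<Rightarrow> 'l::linordered_ab_group_add extended) \<Rightarrow> ('k poly \<Rightarrow> 'l extended) \<Rightarrow> bool" where
  "valuation_transcendental w \<mu> \<longleftrightarrow>
     \<not> (\<forall>g \<in> value_group (fract_val \<mu>). \<exists>n>0. nsmul n g \<in> value_group w) \<or>
     (\<exists>\<xi> \<in> carrier (residue_field (fract_val \<mu>)).
        ring.transcendental (residue_field (fract_val \<mu>)) (base_residue_field w \<mu>) \<xi>)"

subsection \<open>The chain of balls attached to a valuation\<close>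

definition stable_limit ::
  "'i::linorder set \<Rightarrow> ('i \<Rightarrow> 'r \<Rightarrow> 'l extended) \<Rightarrow> ('r \<Rightarrow> 'l extended) \<Rightarrow> bool" where
  "stable_limit I m \<mu> \<longleftrightarrow> (\<forall>f. \<exists>i\<^sub>0\<in>I. \<forall>i\<in>I. i\<^sub>0 \<le> i \<longrightarrow> m i f = \<mu> f)"

definition approximating_family ::
  "('k::field \<Rightarrow> 'a::field) \<Rightarrow> ('a \<Rightarrow> 'l::linordered_ab_group_add extended) \<Rightarrow>
   ('k poly \<Rightarrow> 'l extended) \<Rightarrow> ('a poly \<Rightarrow> 'l extended) \<Rightarrow>
   'i::linorder set \<Rightarrow> ('i \<Rightarrow> 'a) \<Rightarrow> ('i \<Rightarrow> 'l) \<Rightarrow> bool" where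
  "approximating_family \<iota> v \<mu> \<mu>bar I A D \<longleftrightarrow>
     (let mbar = (\<lambda>i. ball_val v (A i) (D i)); m = (\<lambda>i. restrict_val \<iota> (mbar i)) in
        (\<forall>i\<in>I. mbar i \<in> poly_valuations v) \<and> (\<forall>i\<in>I. m i \<in> poly_valuations (v \<circ> \<iota>)) \<and>
        strict_mono_on I mbar \<and> strict_mono_on I m \<and>
        stable_limit I mbar \<mu>bar \<and> stable_limit I m \<mu>)"

text \<open>
  The pair \<open>(a, \<delta>)\<close> is only used if \<open>\<mu>\<close> is valuation-transcendental, and the family \<open>(A, D)\<close>
  indexed by \<open>I\<close> only if it is valuation-algebraic.
\<close>

definition presents ::
  "('k::field \<Rightarrow> 'a::field) \<Rightarrow> ('a \<Rightarrow> 'l::linordered_ab_group_add extended) \<Rightarrow>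
   ('k poly \<Rightarrow> 'l extended) \<Rightarrow> ('a poly \<Rightarrow> 'l extended) \<Rightarrow>
   'a \<Rightarrow> 'l \<Rightarrow> 'i::linorder set \<Rightarrow> ('i \<Rightarrow> 'a) \<Rightarrow> ('i \<Rightarrow> 'l) \<Rightarrow> bool" where
  "presents \<iota> v \<mu> \<mu>bar a \<delta> I A D \<longleftrightarrow>
     (if valuation_transcendental (v \<circ> \<iota>) \<mu> then \<mu>bar = ball_val v a \<delta>
      else approximating_family \<iota> v \<mu> \<mu>bar I A D)"

definition ball_chain ::
  "('k::field \<Rightarrow> 'a::field) \<Rightarrow> ('a \<Rightarrow> 'l::linordered_ab_group_add extended) \<Rightarrow>
   ('k poly \<Rightarrow> 'l extended) \<Rightarrow>
   'a \<Rightarrow> 'l \<Rightarrow> 'i set \<Rightarrow> ('i \<Rightarrow> 'a) \<Rightarrow> ('i \<Rightarrow> 'l) \<Rightarrow> 'a set set" where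
  "ball_chain \<iota> v \<mu> a \<delta> I A D =
     (if valuation_transcendental (v \<circ> \<iota>) \<mu> then {B \<in> all_balls v. vball v a \<delta> \<subseteq> B}
      else {B \<in> all_balls v. \<exists>i\<in>I. vball v (A i) (D i) \<subseteq> B})"

subsection \<open>Optimal balls\<close>

definition optimal_radius ::
  "('k::field \<Rightarrow> 'a::field) \<Rightarrow> ('a \<Rightarrow> 'l::divisible_linordered_ab_group_add extended) \<Rightarrow>
   ('k poly \<Rightarrow> 'l extended) \<Rightarrow> 'a set \<Rightarrow> 'l \<Rightarrow> bool" where
  "optimal_radius \<iota> v \<mu> B \<gamma> \<longleftrightarrow>
     (\<exists>b. B = vball v b \<gamma>) \<and> (\<exists>c \<in> MinK \<iota> B. eps \<mu> (min_poly \<iota> c) = \<gamma>)"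

definition optimal_balls ::
  "('k::field \<Rightarrow> 'a::field) \<Rightarrow> ('a \<Rightarrow> 'l::divisible_linordered_ab_group_add extended) \<Rightarrow>
   ('k poly \<Rightarrow> 'l extended) \<Rightarrow> 'a set set \<Rightarrow> 'a set set" where
  "optimal_balls \<iota> v \<mu> \<B> = {B \<in> \<B>. \<exists>\<gamma>. optimal_radius \<iota> v \<mu> B \<gamma>}"

text \<open>
  As a set, a ball may have presentations with different radii, since \<open>\<Lambda>\<close> can be larger than
  the value group of \<open>v\<close>; only one of these radii witnesses optimality, and it is the one used here.
\<close>

definition Opt ::
  "('k::field \<Rightarrow> 'a::field) \<Rightarrow> ('a \<Rightarrow> 'l::divisible_linordered_ab_group_add extended) \<Rightarrow>
   ('k poly \<Rightarrow> 'l extended) \<Rightarrow> 'a set \<Rightarrow> 'a set" where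
  "Opt \<iota> v \<mu> B =
     {c \<in> MinK \<iota> B. eps \<mu> (min_poly \<iota> c) = (THE \<gamma>. optimal_radius \<iota> v \<mu> B \<gamma>)}"

end

theory Submission
  imports Defs
begin

text \<open>
  Over the algebraic closure a polynomial splits, and comparing the values of the elementary symmetric functions of
  the \<open>x - c\<close> shows that \<open>\<epsilon>\<^sub>\<mu>(f)\<close> is the largest value of \<open>x - c\<close> for \<open>c\<close> a root of \<open>f\<close>.
  Hence \<open>\<epsilon>\<^sub>\<mu>(p\<^sub>K(b)) \<ge> \<gamma>\<close> for all \<open>b\<close> in \<open>{b. \<mu>bar(x - b) \<ge> \<gamma>}\<close>, and every \<open>f\<close> with
  \<open>\<epsilon>\<^sub>\<mu>(f) \<ge> \<gamma>\<close> has a root in this set. A ball of the chain that is optimal with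
  radius \<open>\<gamma>\<close> is equal to this set, so the key polynomials with \<open>\<epsilon>\<^sub>\<mu> = \<gamma>\<close> are the minimal polynomials of
  its elements of minimal degree with \<open>\<epsilon>\<^sub>\<mu> = \<gamma>\<close>, and the ball and its radius determine each other.
\<close>

section \<open>Multiples in ordered groups\<close>

lemma nsmul_0 [simp]: "nsmul 0 x = 0"
  by (simp add: nsmul_def)

lemma nsmul_Suc [simp]: "nsmul (Suc n) x = x + nsmul n x"
  by (simp add: nsmul_def add.commute)

lemma nsmul_strict_mono:
  fixes x y :: "'l::linordered_ab_group_add"
  assumes "n > 0" "x < y"
  shows "nsmul n x < nsmul n y"
  unfolding nsmul_def using assms by (intro sum_strict_mono) auto

lemma nsmul_le_iff:
  fixes x y :: "'l::linordered_ab_group_add"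
  assumes "n > 0"
  shows "nsmul n x \<le> nsmul n y \<longleftrightarrow> x \<le> y"
  using nsmul_strict_mono[OF assms, of x y] nsmul_strict_mono[OF assms, of y x]
  by (metis leD linorder_le_cases order.order_iff_strict)

text \<open>Existence is divisibility; the uniqueness that \<open>THE\<close> requires holds because
  multiplication by a positive \<open>n\<close> is strictly monotone.\<close>

lemma nsmul_ndiv:
  fixes x :: "'l::divisible_linordered_ab_group_add"
  assumes "n > 0"
  shows "nsmul n (ndiv x n) = x"
proof -
  obtain y where y: "nsmul n y = x"
    using divisible[OF assms] by blast
  show ?thesis
    unfolding ndiv_def
    by (rule theI[of "\<lambda>z. nsmul n z = x"], rule y)
       (metis assms dual_order.refl nsmul_le_iff order_antisym y)
qed

lemma ndiv_le_iff:
  fixes x y :: "'l::divisible_linordered_ab_group_add"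
  assumes "n > 0"
  shows "ndiv x n \<le> y \<longleftrightarrow> x \<le> nsmul n y"
  using nsmul_le_iff[OF assms, of "ndiv x n" y] unfolding nsmul_ndiv[OF assms] by simp

lemma ndiv_nsmul:
  fixes y :: "'l::divisible_linordered_ab_group_add"
  assumes "n > 0"
  shows "ndiv (nsmul n y) n = y"
  using nsmul_ndiv[OF assms] nsmul_le_iff[OF assms] by (metis order_antisym order_refl)

section \<open>Valuations\<close>

lemma fin_part_Fin [simp]: "fin_part (Fin l) = l"
  by (simp add: fin_part_def)

context
  fixes w :: "'r::idom \<Rightarrow> 'l::linordered_ab_group_add extended"
  assumes w: "is_valuation w"
begin

lemma val_mult: "w (x * y) = w x + w y"
  using w by (simp add: is_valuation_def)

lemma val_add: "min (w x) (w y) \<le> w (x + y)"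
  using w by (simp add: is_valuation_def)

lemma val_eq_Pinf: "w x = Pinf \<longleftrightarrow> x = 0"
  using w by (simp add: is_valuation_def)

lemma val_fin:
  assumes "x \<noteq> 0"
  obtains l where "w x = Fin l"
  using w assms by (cases "w x") (auto simp: is_valuation_def)

lemma val_fin_part: "x \<noteq> 0 \<Longrightarrow> w x = Fin (fin_part (w x))"
  by (metis fin_part_Fin val_fin)

lemma val_1: "w 1 = 0"
  using val_mult[of 1 1] val_fin[of 1] by (cases "w 1") (auto simp: zero_extended_def)

text \<open>The elements \<open>x\<close> and \<open>- x\<close> have the same square, and doubling
  is injective in an ordered group.\<close>

lemma val_minus: "w (- x) = w x"
proof (cases "x = 0")
  case False
  then obtain a b where ab: "w x = Fin a" "w (- x) = Fin b"
    using val_fin by (metis neg_equal_0_iff_equal)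
  have "w (- x) + w (- x) = w x + w x"
    using val_mult[of "- x" "- x"] val_mult[of x x] by simp
  hence "b + b = a + a"
    using ab by simp
  hence "b = a"
    by (metis add_strict_mono linorder_neq_iff)
  thus ?thesis using ab by simp
qed auto

lemma val_add_ge: "e \<le> w x \<Longrightarrow> e \<le> w y \<Longrightarrow> e \<le> w (x + y)"
  by (meson min.boundedI order_trans val_add)

lemma val_diff_ge: "e \<le> w x \<Longrightarrow> e \<le> w y \<Longrightarrow> e \<le> w (x - y)"
  using val_add_ge[of e x "- y"] by (simp add: val_minus)

lemma val_add_eq:
  assumes "w x < w y"
  shows "w (x + y) = w x"
proof (rule antisym)
  show "w x \<le> w (x + y)"
    using assms by (intro val_add_ge) auto
  show "w (x + y) \<le> w x"
  proof (rule ccontr)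
    assume "\<not> w (x + y) \<le> w x"
    \<comment> \<open>Here \<open>x\<close> is written as \<open>(x + y) - y\<close>.\<close>
    moreover have "min (w (x + y)) (w y) \<le> w x"
      using val_add[of "x + y" "- y"] by (simp add: val_minus)
    ultimately show False
      using assms by (auto simp: min_def split: if_splits)
  qed
qed

end

lemma Fin_add_less_iff:
  fixes x y :: "'l::linordered_ab_group_add extended"
  shows "Fin c + x < Fin c + y \<longleftrightarrow> x < y" "x + Fin c < y + Fin c \<longleftrightarrow> x < y"
    "Fin c + x \<le> Fin c + y \<longleftrightarrow> x \<le> y" "x + Fin c \<le> y + Fin c \<longleftrightarrow> x \<le> y"
  by (cases x; cases y; simp)+

section \<open>Hasse derivatives\<close>

lemma hasse_0_right [simp]: "hasse_deriv s 0 = 0"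
  by (simp add: hasse_deriv_def)

text \<open>Comparing coefficients of powers of \<open>y\<close> in
  \<open>a + (x + y) p(x + y)\<close> gives this recursion and the next one. They allow induction on
  polynomials without unfolding the bivariate definition.\<close>

lemma hasse_pCons_0: "hasse_deriv 0 (pCons a p) = [:a:] + pCons 0 (hasse_deriv 0 p)"
  by (cases "a = 0 \<and> p = 0")
     (auto simp: hasse_deriv_def map_poly_pCons pcompose_pCons coeff_pCons)

lemma hasse_pCons_Suc:
  "hasse_deriv (Suc s) (pCons a p) = pCons 0 (hasse_deriv (Suc s) p) + hasse_deriv s p"
  by (cases "a = 0 \<and> p = 0")
     (auto simp: hasse_deriv_def map_poly_pCons pcompose_pCons coeff_pCons)

lemma hasse_0_left [simp]: "hasse_deriv 0 p = p"
  by (induction p) (auto simp: hasse_pCons_0)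

lemma hasse_smult: "hasse_deriv s (smult c p) = smult c (hasse_deriv s p)"
proof (induction p arbitrary: s)
  case (pCons a p)
  show ?case
    by (cases s) (simp_all add: hasse_pCons_Suc smult_add_right pCons.IH)
qed simp

lemma hasse_add: "hasse_deriv s (p + q) = hasse_deriv s p + hasse_deriv s q"
proof (induction p arbitrary: s q)
  case (pCons a p)
  obtain b q' where q: "q = pCons b q'" by (cases q)
  show ?case
    by (cases s) (simp_all add: q hasse_pCons_Suc pCons.IH)
qed auto

text \<open>Substituting \<open>x + y\<close> turns the factor \<open>x + c\<close> into
  \<open>(x + c) + y\<close>, so only two derivatives of \<open>p\<close> enter.\<close>

lemma hasse_linear_mult:
  "hasse_deriv (Suc s) ([:c, 1:] * p) = [:c, 1:] * hasse_deriv (Suc s) p + hasse_deriv s p"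
  by (simp add: hasse_add hasse_smult hasse_pCons_Suc)

text \<open>This makes the set under \<open>Max\<close> in \<open>eps\<close> finite.\<close>

lemma finite_hasse: "finite {s. hasse_deriv s f \<noteq> 0}"
  unfolding hasse_deriv_def
  by (rule finite_subset[of _ "{..Polynomial.degree (pcompose (map_poly (\<lambda>c. [:c:]) f) [:[:0, 1:], 1:])}"])
     (auto intro: le_degree)

section \<open>The value of \<open>\<epsilon>\<close> in terms of roots\<close>

context
  fixes w :: "'a::alg_closed_field poly \<Rightarrow> 'l::linordered_ab_group_add extended"
  assumes w: "is_valuation w"
begin

abbreviation (input) hasse_val :: "'l \<Rightarrow> nat \<Rightarrow> 'a poly \<Rightarrow> 'l extended" where
  "hasse_val \<delta> s p \<equiv> w (hasse_deriv s p) + Fin (nsmul s \<delta>)"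

text \<open>The weight \<open>nsmul s \<delta>\<close> lets a new linear factor act on the two
  summands of \<open>hasse_linear_mult\<close> by adding \<open>l\<close> to one value and
  \<open>\<delta>\<close> to the other. The rest is the ultrametric inequality, with equality when
  the two values differ.\<close>

lemma hasse_val_linear_mult:
  assumes l: "w [:c, 1:] = Fin l"
  shows "min (Fin l + hasse_val \<delta> (Suc s) p) (Fin \<delta> + hasse_val \<delta> s p)
           \<le> hasse_val \<delta> (Suc s) ([:c, 1:] * p)"
    and "Fin l + hasse_val \<delta> (Suc s) p < Fin \<delta> + hasse_val \<delta> s p \<Longrightarrow>
      hasse_val \<delta> (Suc s) ([:c, 1:] * p) = Fin l + hasse_val \<delta> (Suc s) p"
    and "Fin \<delta> + hasse_val \<delta> s p < Fin l + hasse_val \<delta> (Suc s) p \<Longrightarrow>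
      hasse_val \<delta> (Suc s) ([:c, 1:] * p) = Fin \<delta> + hasse_val \<delta> s p"
proof -
  define x y where "x = [:c, 1:] * hasse_deriv (Suc s) p" and "y = hasse_deriv s p"
  define e where "e = Fin (nsmul (Suc s) \<delta>)"
  have h: "hasse_deriv (Suc s) ([:c, 1:] * p) = x + y"
    unfolding x_def y_def by (rule hasse_linear_mult)
  have x: "Fin l + hasse_val \<delta> (Suc s) p = w x + e"
    by (simp only: x_def e_def val_mult[OF w] l add.assoc)
  have y: "Fin \<delta> + hasse_val \<delta> s p = w y + e"
    by (cases "w y") (simp_all add: y_def e_def ac_simps)
  show "min (Fin l + hasse_val \<delta> (Suc s) p) (Fin \<delta> + hasse_val \<delta> s p)
          \<le> hasse_val \<delta> (Suc s) ([:c, 1:] * p)"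
    unfolding x y h unfolding e_def[symmetric] using val_add[OF w, of x y]
    by (auto simp: min_def e_def Fin_add_less_iff split: if_splits)
  show "hasse_val \<delta> (Suc s) ([:c, 1:] * p) = Fin l + hasse_val \<delta> (Suc s) p"
    if "Fin l + hasse_val \<delta> (Suc s) p < Fin \<delta> + hasse_val \<delta> s p"
    using that val_add_eq[OF w, of x y] unfolding x y h unfolding e_def[symmetric]
    by (simp add: e_def Fin_add_less_iff)
  show "hasse_val \<delta> (Suc s) ([:c, 1:] * p) = Fin \<delta> + hasse_val \<delta> s p"
    if "Fin \<delta> + hasse_val \<delta> s p < Fin l + hasse_val \<delta> (Suc s) p"
    using that val_add_eq[OF w, of y x] unfolding x y h unfolding e_def[symmetric]
    by (simp add: e_def Fin_add_less_iff add.commute)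
qed

text \<open>
  The derivative of order \<open>m\<close>, the number of factors of maximal value, has a unique dominant term.
  The strict inequality beyond \<open>m\<close> makes the induction go through.
\<close>

lemma hasse_val_prod:
  fixes R :: "'a multiset"
  assumes "\<And>c. c \<in># R \<Longrightarrow> w [:- c, 1:] \<le> Fin \<delta>"
  defines "p \<equiv> (\<Prod>c\<in>#R. [:- c, 1:])"
    and "m \<equiv> size (filter_mset (\<lambda>c. w [:- c, 1:] = Fin \<delta>) R)"
  shows "w p \<le> hasse_val \<delta> s p" and "hasse_val \<delta> m p = w p"
    and "s > m \<Longrightarrow> w p < hasse_val \<delta> s p"
proof -
  have "(\<forall>s. w p \<le> hasse_val \<delta> s p) \<and> hasse_val \<delta> m p = w p \<and> (\<forall>s>m. w p < hasse_val \<delta> s p)"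
    unfolding p_def m_def using assms(1)
  proof (induction R)
    case empty
    \<comment> \<open>Without factors the dominant order is 0, and all derivatives of positive order
      vanish, with value \<open>Pinf\<close>.\<close>
    have "hasse_deriv s (1 :: 'a poly) = (if s = 0 then 1 else 0)" for s
      using hasse_pCons_Suc[of _ 1 0] by (cases s) (auto simp: one_pCons)
    hence "hasse_val \<delta> s 1 = (if s = 0 then Fin 0 else Pinf)" for s
      using val_eq_Pinf[OF w, of 0] val_1[OF w] by (simp add: zero_extended_def)
    thus ?case
      using val_1[OF w] by (simp add: zero_extended_def)
  next
    case (add c R)
    define p m where "p = (\<Prod>c\<in>#R. [:- c, 1:])"
      and "m = size (filter_mset (\<lambda>c. w [:- c, 1:] = Fin \<delta>) R)"
    have "w [:- b, 1:] \<le> Fin \<delta>" if "b \<in># R" for b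
      using add.prems[of b] that by simp
    note add.IH[OF this, folded p_def m_def]
    hence IH: "w p \<le> hasse_val \<delta> s p" "hasse_val \<delta> m p = w p"
      "s > m \<Longrightarrow> w p < hasse_val \<delta> s p" for s
      by blast+
    obtain l where l: "w [:- c, 1:] = Fin l"
      using val_fin[OF w, of "[:- c, 1:]"] by auto
    have l\<delta>: "l \<le> \<delta>"
      using add.prems[of c] l by simp
    define q where "q = [:- c, 1:] * p"
    have q: "(\<Prod>c\<in>#add_mset c R. [:- c, 1:]) = q"
      by (simp add: q_def p_def)
    have wq: "w q = Fin l + w p"
      unfolding q_def val_mult[OF w] l ..
    have "p \<noteq> 0" by (auto simp: p_def prod_mset_zero_iff)
    then obtain P where P: "w p = Fin P" using val_fin[OF w] by blast
    note step = hasse_val_linear_mult[OF l, where \<delta> = \<delta> and p = p, folded q_def]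
    have le: "w q \<le> hasse_val \<delta> s q" for s
    proof (cases s)
      case (Suc t)
      have "w q \<le> Fin l + hasse_val \<delta> (Suc t) p"
        using IH(1)[of "Suc t"] unfolding wq Fin_add_less_iff .
      moreover have "w q \<le> Fin \<delta> + hasse_val \<delta> t p"
        unfolding wq by (intro add_mono IH(1)) (simp add: l\<delta>)
      ultimately show ?thesis
        unfolding Suc by (intro order_trans[OF _ step(1)] min.boundedI)
    qed (simp add: zero_extended_def[symmetric])
    show ?case
    proof (cases "l = \<delta>")
      case True
      have m: "size (filter_mset (\<lambda>c. w [:- c, 1:] = Fin \<delta>) (add_mset c R)) = Suc m"
        using True l by (simp add: m_def)
      \<comment> \<open>A factor of maximal value shifts the dominant order by one. The competing
        term comes from order \<open>Suc m\<close> of \<open>p\<close> and is strictly larger by the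
        induction hypothesis.\<close>
      have "hasse_val \<delta> (Suc m) q = Fin \<delta> + hasse_val \<delta> m p"
        using IH(3)[of "Suc m"] True
        by (intro step(3)) (simp only: IH(2) Fin_add_less_iff lessI)
      hence 2: "hasse_val \<delta> (Suc m) q = w q"
        by (simp only: IH(2) True wq)
      have "w q < hasse_val \<delta> s q" if sm: "s > Suc m" for s
      proof -
        obtain t where t: "s = Suc t" "t > m" using sm by (cases s) auto
        have 1: "w q < Fin l + hasse_val \<delta> (Suc t) p"
          unfolding wq Fin_add_less_iff by (rule IH(3)) (use t in simp)
        have 2: "w q < Fin \<delta> + hasse_val \<delta> t p"
          unfolding wq True Fin_add_less_iff by (rule IH(3)) (use t in simp)
        show ?thesis
          unfolding t by (rule order.strict_trans2[OF _ step(1)]) (simp only: min_less_iff_conj 1 2)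
      qed
      thus ?thesis unfolding q m using le 2 by blast
    next
      case False
      have m: "size (filter_mset (\<lambda>c. w [:- c, 1:] = Fin \<delta>) (add_mset c R)) = m"
        using False l by (simp add: m_def)
      \<comment> \<open>For \<open>l < \<delta>\<close> the summand coming from the lower order
        always exceeds \<open>w q\<close>, so the dominant order stays at \<open>m\<close>.\<close>
      have less: "w q < Fin \<delta> + hasse_val \<delta> t p" for t
      proof -
        have "w q < Fin \<delta> + w p" using False l\<delta> by (simp add: wq P)
        also have "\<dots> \<le> Fin \<delta> + hasse_val \<delta> t p" using IH(1)[of t] unfolding Fin_add_less_iff .
        finally show ?thesis .
      qed
      have 2: "hasse_val \<delta> m q = w q"
      proof (cases m)
        case (Suc t)
        have "Fin l + hasse_val \<delta> (Suc t) p = w q"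
          using IH(2) unfolding wq Suc by (simp only:)
        thus ?thesis using step(2)[of t] less[of t] unfolding Suc by (simp only:)
      qed (simp add: zero_extended_def[symmetric])
      have "w q < hasse_val \<delta> s q" if sm: "s > m" for s
      proof -
        obtain t where t: "s = Suc t" using sm by (cases s) auto
        have 1: "w q < Fin l + hasse_val \<delta> (Suc t) p"
          unfolding wq Fin_add_less_iff by (rule IH(3)) (use sm t in simp)
        show ?thesis
          unfolding t by (rule order.strict_trans2[OF _ step(1)]) (simp only: min_less_iff_conj 1 less)
      qed
      thus ?thesis unfolding q m using le 2 by blast
    qed
  qed
  thus "w p \<le> hasse_val \<delta> s p" "hasse_val \<delta> m p = w p" "s > m \<Longrightarrow> w p < hasse_val \<delta> s p"
    by auto
qed

end

text \<open>Let \<open>\<delta>\<close> be the largest value of \<open>x - c\<close> over the roots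
  \<open>c\<close>. By \<open>hasse_val_prod\<close> each quotient in the definition of
  \<open>eps\<close> is at most \<open>\<delta>\<close>, and the one of order \<open>m\<close> is
  equal to it.\<close>

lemma eps_alg_closed:
  fixes w :: "'a::alg_closed_field poly \<Rightarrow> 'l::divisible_linordered_ab_group_add extended"
  assumes w: "is_valuation w" and f: "Polynomial.degree f > 0"
  shows "poly f c = 0 \<Longrightarrow> w [:- c, 1:] \<le> Fin (eps w f)"
    and "\<exists>c. poly f c = 0 \<and> w [:- c, 1:] = Fin (eps w f)"
proof -
  have f0: "f \<noteq> 0" using f by auto
  obtain R where R: "size R = Polynomial.degree f"
      "f = smult (Polynomial.lead_coeff f) (\<Prod>x\<in>#R. [:- x, 1:])"
    using alg_closed_imp_factorization[OF f0] by blast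
  define p k where "p = (\<Prod>x\<in>#R. [:- x, 1:])" and "k = Polynomial.lead_coeff f"
  have k0: "k \<noteq> 0" using f0 by (simp add: k_def)
  have fkp: "f = smult k p" using R(2) by (simp add: p_def k_def)
  have root: "poly f c = 0 \<longleftrightarrow> c \<in># R" for c
    using k0 by (auto simp: fkp p_def poly_prod_mset prod_mset_zero_iff)
  have lin: "w [:- c, 1:] = Fin (fin_part (w [:- c, 1:]))" for c
    by (rule val_fin_part[OF w]) auto
  define \<delta> where "\<delta> = Max ((\<lambda>c. fin_part (w [:- c, 1:])) ` set_mset R)"
  have R0: "R \<noteq> {#}" using R(1) f by auto
  have le: "w [:- c, 1:] \<le> Fin \<delta>" if "c \<in># R" for c
    using that by (subst lin) (auto simp: \<delta>_def)
  have "\<delta> \<in> (\<lambda>c. fin_part (w [:- c, 1:])) ` set_mset R"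
    unfolding \<delta>_def using R0 by (intro Max_in) auto
  then obtain c0 where c0: "c0 \<in># R" "w [:- c0, 1:] = Fin \<delta>"
    using lin by auto
  define m where "m = size (filter_mset (\<lambda>c. w [:- c, 1:] = Fin \<delta>) R)"
  have "c0 \<in># filter_mset (\<lambda>c. w [:- c, 1:] = Fin \<delta>) R"
    using c0 by simp
  \<comment> \<open>Positivity matters because the maximum in \<open>eps\<close> only runs over
    \<open>s \<ge> 1\<close>.\<close>
  hence m: "m \<ge> 1"
    unfolding m_def by (metis One_nat_def Suc_leI empty_iff nonempty_has_size set_mset_empty)
  obtain \<kappa> where \<kappa>: "w [:k:] = Fin \<kappa>" using k0 val_fin[OF w, of "[:k:]"] by auto
  have smult: "w (smult k q) = Fin \<kappa> + w q" for q
    using val_mult[OF w, of "[:k:]" q] \<kappa> by simp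
  have pv1: "w p \<le> w (hasse_deriv s p) + Fin (nsmul s \<delta>)" for s
    unfolding p_def by (rule hasse_val_prod(1)[OF w le])
  have pv2: "w (hasse_deriv m p) + Fin (nsmul m \<delta>) = w p"
    unfolding p_def m_def by (rule hasse_val_prod(2)[OF w le])
  have h: "w (hasse_deriv s f) + Fin (nsmul s \<delta>) = Fin \<kappa> + (w (hasse_deriv s p) + Fin (nsmul s \<delta>))" for s
    by (simp only: fkp hasse_smult smult add.assoc)
  have f1: "w f \<le> w (hasse_deriv s f) + Fin (nsmul s \<delta>)" for s
    using pv1[of s] unfolding h unfolding fkp smult Fin_add_less_iff .
  have f2: "w (hasse_deriv m f) + Fin (nsmul m \<delta>) = w f"
    using pv2 unfolding h unfolding fkp smult by simp
  obtain F where F: "w f = Fin F" using val_fin[OF w f0] by blast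
  have m0: "hasse_deriv m f \<noteq> 0"
    using f2 F val_eq_Pinf[OF w, of 0] by (cases "w (hasse_deriv m f)") auto
  define S where "S = {ndiv (fin_part (w f) - fin_part (w (hasse_deriv s f))) s
          | s. s \<ge> 1 \<and> hasse_deriv s f \<noteq> 0}"
  have "finite S"
    unfolding S_def using finite_hasse[of f] by (auto simp: setcompr_eq_image)
  moreover have "\<delta> \<in> S"
  proof -
    have "w (hasse_deriv m f) = Fin (fin_part (w (hasse_deriv m f)))"
      by (rule val_fin_part[OF w m0])
    hence "F - fin_part (w (hasse_deriv m f)) = nsmul m \<delta>"
      using f2 F by (metis add_diff_cancel_left' extended.inject plus_extended.simps(1))
    hence "\<delta> = ndiv (fin_part (w f) - fin_part (w (hasse_deriv m f))) m"
      using m ndiv_nsmul[of m \<delta>] F by simp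
    thus ?thesis unfolding S_def using m m0 by blast
  qed
  moreover have "x \<le> \<delta>" if "x \<in> S" for x
  proof -
    from that obtain s where s: "s \<ge> 1" "hasse_deriv s f \<noteq> 0"
      "x = ndiv (fin_part (w f) - fin_part (w (hasse_deriv s f))) s"
      unfolding S_def by blast
    obtain h where h: "w (hasse_deriv s f) = Fin h" using val_fin[OF w s(2)] by blast
    have "F - h \<le> nsmul s \<delta>"
      using f1[of s] h F by (simp add: algebra_simps)
    thus ?thesis using s h F ndiv_le_iff[of s "F - h" \<delta>] by simp
  qed
  ultimately have "Max S = \<delta>" by (intro Max_eqI) auto
  hence eps: "eps w f = \<delta>" by (simp add: eps_def S_def)
  show "w [:- c, 1:] \<le> Fin (eps w f)" if "poly f c = 0"
    using that le root eps by simp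
  show "\<exists>c. poly f c = 0 \<and> w [:- c, 1:] = Fin (eps w f)"
    using c0 root eps by auto
qed

section \<open>Descent to the base field\<close>

locale algebraic_closure =
  fixes \<iota> :: "'k::field \<Rightarrow> 'a::alg_closed_field"
  assumes closure: "is_alg_closure \<iota>"
begin

lemma \<iota>_1 [simp]: "\<iota> 1 = 1" and \<iota>_add: "\<iota> (x + y) = \<iota> x + \<iota> y" and \<iota>_mult: "\<iota> (x * y) = \<iota> x * \<iota> y"
  using closure by (auto simp: is_alg_closure_def)

lemma \<iota>_0 [simp]: "\<iota> 0 = 0"
  using \<iota>_add[of 0 0] by (metis add.right_neutral add_left_cancel)

lemma \<iota>_eq_0 [simp]: "\<iota> x = 0 \<longleftrightarrow> x = 0"
  by (metis \<iota>_0 \<iota>_1 \<iota>_mult mult_zero_left one_neq_zero right_inverse)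

lemma map_poly_\<iota>_add: "map_poly \<iota> (p + q) = map_poly \<iota> p + map_poly \<iota> q"
  by (intro poly_eqI) (simp add: coeff_map_poly \<iota>_add)

lemma map_poly_\<iota>_smult: "map_poly \<iota> (smult c p) = smult (\<iota> c) (map_poly \<iota> p)"
  by (intro poly_eqI) (simp add: coeff_map_poly \<iota>_mult)

lemma map_poly_\<iota>_pCons: "map_poly \<iota> (pCons c p) = pCons (\<iota> c) (map_poly \<iota> p)"
  by (simp add: map_poly_pCons)

lemma map_poly_\<iota>_eq_0 [simp]: "map_poly \<iota> p = 0 \<longleftrightarrow> p = 0"
  by (simp add: map_poly_eq_0_iff)

lemma degree_map_poly_\<iota> [simp]: "Polynomial.degree (map_poly \<iota> p) = Polynomial.degree p"
  by (intro degree_map_poly) simp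

lemma map_poly_\<iota>_hasse: "map_poly \<iota> (hasse_deriv s p) = hasse_deriv s (map_poly \<iota> p)"
proof (induction p arbitrary: s)
  case (pCons c p)
  show ?case
    by (cases s) (simp_all add: hasse_pCons_Suc map_poly_\<iota>_pCons map_poly_\<iota>_add pCons.IH)
qed simp

text \<open>Hasse derivatives commute with extension of scalars, which also preserves whether they
  vanish. The description of \<open>eps\<close> by roots thus becomes available over the base
  field.\<close>

lemma eps_restrict_val: "eps (restrict_val \<iota> w) f = eps w (map_poly \<iota> f)"
  by (simp add: eps_def restrict_val_def map_poly_\<iota>_hasse[symmetric])

lemma ex1_min_poly:
  "\<exists>!p. Polynomial.lead_coeff p = 1 \<and> poly (map_poly \<iota> p) c = 0 \<and>
     (\<forall>q. q \<noteq> 0 \<and> poly (map_poly \<iota> q) c = 0 \<longrightarrow> Polynomial.degree p \<le> Polynomial.degree q)"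
proof (rule ex_ex1I)
  let ?P = "\<lambda>p. p \<noteq> 0 \<and> poly (map_poly \<iota> p) c = 0"
  obtain p0 where "?P p0"
    using closure unfolding is_alg_closure_def by blast
  then obtain p where p: "?P p" "\<And>q. ?P q \<Longrightarrow> Polynomial.degree p \<le> Polynomial.degree q"
    using exists_least_iff[of "\<lambda>n. \<exists>p. ?P p \<and> Polynomial.degree p = n"] by (metis not_le_imp_less)
  show "\<exists>p. Polynomial.lead_coeff p = 1 \<and> poly (map_poly \<iota> p) c = 0 \<and>
     (\<forall>q. ?P q \<longrightarrow> Polynomial.degree p \<le> Polynomial.degree q)"
    by (rule exI[of _ "smult (inverse (Polynomial.lead_coeff p)) p"])
       (use p in \<open>auto simp: map_poly_\<iota>_smult\<close>)
next
  fix p q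
  assume p: "Polynomial.lead_coeff p = 1 \<and> poly (map_poly \<iota> p) c = 0 \<and>
     (\<forall>q. q \<noteq> 0 \<and> poly (map_poly \<iota> q) c = 0 \<longrightarrow> Polynomial.degree p \<le> Polynomial.degree q)"
   and q: "Polynomial.lead_coeff q = 1 \<and> poly (map_poly \<iota> q) c = 0 \<and>
     (\<forall>p. p \<noteq> 0 \<and> poly (map_poly \<iota> p) c = 0 \<longrightarrow> Polynomial.degree q \<le> Polynomial.degree p)"
  have deg: "Polynomial.degree p = Polynomial.degree q"
    using p q by (metis leading_coeff_0_iff order_antisym zero_neq_one)
  \<comment> \<open>The leading terms cancel, so a nonzero difference would vanish at
    \<open>c\<close> with a degree below the minimum.\<close>
  define r where "r = p + smult (- 1) q"
  have root: "poly (map_poly \<iota> r) c = 0"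
    using p q by (simp add: r_def map_poly_\<iota>_add map_poly_\<iota>_smult del: smult_minus_left)
  have "Polynomial.coeff r (Polynomial.degree p) = 0"
    using p q deg by (simp add: r_def)
  moreover have "Polynomial.degree r \<le> Polynomial.degree p"
    using deg by (simp add: r_def degree_diff_le)
  moreover have "r \<noteq> 0 \<Longrightarrow> Polynomial.degree p \<le> Polynomial.degree r"
    using p root by blast
  ultimately have "r = 0"
    by (metis leading_coeff_0_iff order_antisym)
  thus "p = q" by (simp add: r_def)
qed

lemmas min_poly_props = theI'[OF ex1_min_poly, folded min_poly_def]

lemma lead_coeff_min_poly: "Polynomial.lead_coeff (min_poly \<iota> c) = 1"
  and root_min_poly: "poly (map_poly \<iota> (min_poly \<iota> c)) c = 0"
  using min_poly_props[of c] by auto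

lemma degree_min_poly_le:
  "q \<noteq> 0 \<Longrightarrow> poly (map_poly \<iota> q) c = 0 \<Longrightarrow> Polynomial.degree (min_poly \<iota> c) \<le> Polynomial.degree q"
  using min_poly_props[of c] by auto

text \<open>This recognises a minimal polynomial by its degree alone, without an irreducibility
  argument.\<close>

lemma min_poly_eqI:
  assumes "Polynomial.lead_coeff q = 1" "poly (map_poly \<iota> q) c = 0"
    and "Polynomial.degree q \<le> Polynomial.degree (min_poly \<iota> c)"
  shows "min_poly \<iota> c = q"
  using ex1_min_poly[of c] min_poly_props[of c] assms by (metis order_trans)

lemma degree_min_poly_pos: "Polynomial.degree (min_poly \<iota> c) > 0"
proof (rule ccontr)
  assume "\<not> ?thesis"
  then obtain a where a: "min_poly \<iota> c = [:a:]" by (auto elim: degree_eq_zeroE)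
  thus False
    using lead_coeff_min_poly[of c] root_min_poly[of c] by (simp add: map_poly_\<iota>_pCons)
qed

lemma MinK_iff: "c \<in> MinK \<iota> S \<longleftrightarrow> c \<in> S \<and> (\<forall>b\<in>S. degK \<iota> c \<le> degK \<iota> b)"
proof
  assume "c \<in> MinK \<iota> S"
  thus "c \<in> S \<and> (\<forall>b\<in>S. degK \<iota> c \<le> degK \<iota> b)"
    unfolding MinK_def degK_set_def by (auto intro: Least_le)
next
  assume "c \<in> S \<and> (\<forall>b\<in>S. degK \<iota> c \<le> degK \<iota> b)"
  thus "c \<in> MinK \<iota> S"
    unfolding MinK_def degK_set_def by (auto intro!: Least_equality[symmetric])
qed

end

section \<open>The chain of balls\<close>

text \<open>The expansion is \<open>x - c = (a - c) + (x - a)\<close>, and the coefficient 1 has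
  value 0.\<close>

lemma ball_val_linear:
  assumes v: "is_valuation v"
  shows "ball_val v a \<delta> [:- c, 1:] = min (v (a - c)) (Fin \<delta>)"
proof -
  have "pcompose [:- c, 1:] [:a, 1:] = [:a - c, 1:]"
    by (simp add: pcompose_pCons)
  moreover have "{..Suc 0} = {0, Suc 0}" by auto
  ultimately show ?thesis
    using val_1[OF v] by (simp add: ball_val_def zero_extended_def[symmetric])
qed

text \<open>
  The common feature of the two cases in the definition of \<open>presents\<close>: \<open>T\<close> consists of the pairs
  \<open>(a, \<delta>)\<close> that generate the chain.
\<close>

definition ball_basis ::
  "('a::field \<Rightarrow> 'l::linordered_ab_group_add extended) \<Rightarrow> ('a poly \<Rightarrow> 'l extended) \<Rightarrow>
   ('a \<times> 'l) set \<Rightarrow> bool" where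
  "ball_basis v w T \<longleftrightarrow>
     (\<forall>(a, \<delta>)\<in>T. \<forall>c. min (v (a - c)) (Fin \<delta>) \<le> w [:- c, 1:]) \<and>
     T \<noteq> {} \<and>
     (\<forall>c. \<forall>(a\<^sub>0, \<delta>\<^sub>0)\<in>T. \<exists>(a, \<delta>)\<in>T.
        w [:- c, 1:] = min (v (a - c)) (Fin \<delta>) \<and> vball v a \<delta> \<subseteq> vball v a\<^sub>0 \<delta>\<^sub>0)"

lemma ball_basis_le:
  "ball_basis v w T \<Longrightarrow> (a, \<delta>) \<in> T \<Longrightarrow> min (v (a - c)) (Fin \<delta>) \<le> w [:- c, 1:]"
  by (auto simp: ball_basis_def)

lemma ball_basis_nonempty:
  assumes "ball_basis v w T"
  obtains a \<delta> where "(a, \<delta>) \<in> T"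
  using assms by (auto simp: ball_basis_def)

lemma ball_basis_eq:
  assumes "ball_basis v w T" "(a\<^sub>0, \<delta>\<^sub>0) \<in> T"
  obtains a \<delta> where "(a, \<delta>) \<in> T" "w [:- c, 1:] = min (v (a - c)) (Fin \<delta>)"
    "vball v a \<delta> \<subseteq> vball v a\<^sub>0 \<delta>\<^sub>0"
proof -
  have "\<forall>(a\<^sub>0, \<delta>\<^sub>0)\<in>T. \<exists>(a, \<delta>)\<in>T.
      w [:- c, 1:] = min (v (a - c)) (Fin \<delta>) \<and> vball v a \<delta> \<subseteq> vball v a\<^sub>0 \<delta>\<^sub>0"
    using assms(1) unfolding ball_basis_def by blast
  from bspec[OF this assms(2)] show ?thesis
    using that by auto
qed

lemma center_in_vball:
  assumes "is_valuation v"
  shows "a \<in> vball v a \<delta>"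
  using val_eq_Pinf[OF assms, of 0] by (simp add: vball_def)

lemma vball_antimono: "\<gamma> \<le> \<delta> \<Longrightarrow> vball v a \<delta> \<subseteq> vball v a \<gamma>"
  by (auto simp: vball_def intro: order_trans[of "Fin \<gamma>" "Fin \<delta>"])

text \<open>By the ultrametric inequality, moving the center by a difference of value at least
  \<open>\<gamma>\<close> does not affect membership.\<close>

lemma vball_eq:
  assumes v: "is_valuation v" and "c \<in> vball v b \<gamma>"
  shows "vball v b \<gamma> = vball v c \<gamma>"
proof -
  have cb: "Fin \<gamma> \<le> v (c - b)"
    using assms(2) by (simp add: vball_def)
  have "Fin \<gamma> \<le> v (x - c) \<longleftrightarrow> Fin \<gamma> \<le> v (x - b)" for x
    using val_add_ge[OF v, of "Fin \<gamma>" "x - c" "c - b"] val_diff_ge[OF v, of "Fin \<gamma>" "x - b" "c - b"] cb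
    by auto
  thus ?thesis by (auto simp: vball_def)
qed

lemma val_diff_commute: "is_valuation v \<Longrightarrow> v (a - b) = v (b - a)"
  using val_minus[of v "a - b"] by simp

text \<open>In the valuation-transcendental case one pair suffices. Otherwise \<open>T\<close> is
  the whole approximating family: monotonicity gives the nesting, and together with stability the
  bounds and the equalities.\<close>

lemma presents_ball_basis:
  fixes v :: "'a::alg_closed_field \<Rightarrow> 'l::divisible_linordered_ab_group_add extended"
  assumes v: "is_valuation v" and pres: "presents \<iota> v \<mu> w a \<delta> I A D"
  obtains T where "ball_basis v w T"
    and "ball_chain \<iota> v \<mu> a \<delta> I A D = {B \<in> all_balls v. \<exists>(a, \<delta>)\<in>T. vball v a \<delta> \<subseteq> B}"
proof (cases "valuation_transcendental (v \<circ> \<iota>) \<mu>")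
  case True
  show ?thesis
    using True pres ball_val_linear[OF v]
    by (intro that[of "{(a, \<delta>)}"]) (auto simp: ball_basis_def presents_def ball_chain_def)
next
  case False
  define mbar where "mbar i = ball_val v (A i) (D i)" for i
  have mono: "strict_mono_on I mbar" and lim: "stable_limit I mbar w"
    using False pres
    by (auto simp: presents_def approximating_family_def Let_def mbar_def[abs_def])
  have le: "mbar i f \<le> mbar j f" if "i \<in> I" "j \<in> I" "i \<le> j" for i j f
  proof -
    have "mbar i \<le> mbar j"
      using that strict_mono_onD[OF mono, of i j] by (cases "i = j") (auto intro: less_imp_le)
    thus ?thesis by (rule le_funD)
  qed
  \<comment> \<open>Stability is put in cofinal form, so that the stable value is reached beyond any
    given index.\<close>
  have ev: "\<exists>j\<in>I. i \<le> j \<and> mbar j f = w f" if i: "i \<in> I" for i f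
  proof -
    obtain i0 where i0: "i0 \<in> I" "\<forall>j\<in>I. i0 \<le> j \<longrightarrow> mbar j f = w f"
      using lim by (auto simp: stable_limit_def)
    thus ?thesis using i by (intro bexI[of _ "max i i0"]) (auto simp: max_def)
  qed
  have lin: "mbar i [:- c, 1:] = min (v (A i - c)) (Fin (D i))" for i c
    by (simp add: mbar_def ball_val_linear[OF v])
  have sub: "vball v (A j) (D j) \<subseteq> vball v (A i) (D i)" if ij: "i \<in> I" "j \<in> I" "i \<le> j" for i j
  proof -
    \<comment> \<open>Evaluating at \<open>x - A i\<close> compares centers and radii at once; the
      value at index \<open>i\<close> is \<open>Fin (D i)\<close> because
      \<open>v 0 = Pinf\<close>.\<close>
    have "Fin (D i) \<le> min (v (A j - A i)) (Fin (D j))"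
      using le[OF ij, of "[:- A i, 1:]"] val_eq_Pinf[OF v, of 0] by (simp only: lin) simp
    hence *: "A j \<in> vball v (A i) (D i)" "D i \<le> D j"
      by (auto simp: vball_def)
    show ?thesis
      unfolding vball_eq[OF v *(1)] by (rule vball_antimono[OF *(2)])
  qed
  show ?thesis
  proof (rule that[of "(\<lambda>i. (A i, D i)) ` I"])
    have "mbar i f \<le> w f" if "i \<in> I" for i f
      using ev[OF that, of f] le[OF that] by metis
    hence "min (v (A i - c)) (Fin (D i)) \<le> w [:- c, 1:]" if "i \<in> I" for i c
      using that lin by metis
    moreover have "I \<noteq> {}"
      using lim by (auto simp: stable_limit_def)
    moreover have "\<exists>j\<in>I. w [:- c, 1:] = min (v (A j - c)) (Fin (D j)) \<and>
        vball v (A j) (D j) \<subseteq> vball v (A i) (D i)" if "i \<in> I" for i c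
      using ev[OF that, of "[:- c, 1:]"] sub[OF that] lin by metis
    ultimately show "ball_basis v w ((\<lambda>i. (A i, D i)) ` I)"
      unfolding ball_basis_def by fastforce
  qed (use False in \<open>auto simp: ball_chain_def\<close>)
qed

text \<open>The variable cancels in \<open>(x - c) - (x - b) = b - c\<close>.\<close>

lemma linear_val_diff_ge:
  assumes w: "w \<in> poly_valuations v"
    and "Fin \<gamma> \<le> w [:- b, 1:]" "Fin \<gamma> \<le> w [:- c, 1:]"
  shows "Fin \<gamma> \<le> v (b - c)"
proof -
  have "Fin \<gamma> \<le> w ([:- c, 1:] - [:- b, 1:])"
    using assms by (intro val_diff_ge[of w]) (simp_all add: poly_valuations_def)
  thus ?thesis using w by (simp add: poly_valuations_def)
qed

lemma linear_val_ge:
  assumes w: "w \<in> poly_valuations v"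
    and "Fin \<gamma> \<le> w [:- c, 1:]" "Fin \<gamma> \<le> v (c - b)"
  shows "Fin \<gamma> \<le> w [:- b, 1:]"
proof -
  have "Fin \<gamma> \<le> w ([:- c, 1:] + [:c - b:])"
    using assms by (intro val_add_ge[of w]) (simp_all add: poly_valuations_def)
  thus ?thesis by simp
qed

text \<open>Some basis pair computes the value at \<open>x - c\<close> as a minimum equal to
  \<open>\<gamma>\<close>. Hence its center lies in the ball around \<open>c\<close> and its radius
  is at least \<open>\<gamma>\<close>.\<close>

lemma vball_in_chain:
  assumes v: "is_valuation v" and T: "ball_basis v w T"
    and c: "w [:- c, 1:] = Fin \<gamma>"
  shows "\<exists>(a, \<delta>)\<in>T. vball v a \<delta> \<subseteq> vball v c \<gamma>"
proof -
  obtain a \<delta> where a: "(a, \<delta>) \<in> T" "min (v (a - c)) (Fin \<delta>) = Fin \<gamma>"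
    using ball_basis_nonempty[OF T] ball_basis_eq[OF T, of _ _ c] c by metis
  have "Fin \<gamma> \<le> v (a - c)" "\<gamma> \<le> \<delta>"
    using min.cobounded1[of "v (a - c)" "Fin \<delta>"] min.cobounded2[of "v (a - c)" "Fin \<delta>"]
    unfolding a(2) by simp_all
  hence "a \<in> vball v c \<gamma>"
    by (simp add: vball_def)
  hence "vball v a \<delta> \<subseteq> vball v c \<gamma>"
    using vball_eq[OF v] vball_antimono[OF \<open>\<gamma> \<le> \<delta>\<close>] by metis
  thus ?thesis using a(1) by blast
qed

text \<open>
  The root \<open>c\<close> bounds \<open>\<gamma>\<close> by the radii of the basis; without it, gaps in the value group of \<open>v\<close>
  would allow presentations of \<open>B\<close> with larger radii.
\<close>

lemma chain_ball_eq:
  assumes v: "is_valuation v" and w: "w \<in> poly_valuations v" and T: "ball_basis v w T"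
    and B: "B = vball v b \<gamma>" "\<exists>(a, \<delta>)\<in>T. vball v a \<delta> \<subseteq> B"
    and c: "w [:- c, 1:] = Fin \<gamma>"
  shows "B = {x. Fin \<gamma> \<le> w [:- x, 1:]}"
proof -
  obtain a0 \<delta>0 where 0: "(a0, \<delta>0) \<in> T" "vball v a0 \<delta>0 \<subseteq> B"
    using B(2) by blast
  \<comment> \<open>A basis ball inside the given one is chosen that also computes the value at
    \<open>x - c\<close>: its center lies in \<open>B\<close>, and its radius is at least
    \<open>\<gamma>\<close>.\<close>
  obtain a \<delta> where a: "(a, \<delta>) \<in> T" "Fin \<gamma> = min (v (a - c)) (Fin \<delta>)"
      "vball v a \<delta> \<subseteq> vball v a0 \<delta>0"
    using ball_basis_eq[OF T 0(1), of c] unfolding c .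
  have "a \<in> B"
    using center_in_vball[OF v, of a \<delta>] a(3) 0(2) by blast
  hence Ba: "B = vball v a \<gamma>"
    using vball_eq[OF v] B(1) by blast
  have "min (v (a - a)) (Fin \<delta>) \<le> w [:- a, 1:]"
    by (rule ball_basis_le[OF T a(1)])
  hence "Fin \<delta> \<le> w [:- a, 1:]"
    using val_eq_Pinf[OF v, of 0] by simp
  moreover have "Fin \<gamma> \<le> Fin \<delta>"
    unfolding a(2) by simp
  ultimately have aw: "Fin \<gamma> \<le> w [:- a, 1:]"
    using order_trans by blast
  show ?thesis
    unfolding Ba vball_def
  proof (intro Collect_cong iffI)
    fix x assume "Fin \<gamma> \<le> v (x - a)"
    thus "Fin \<gamma> \<le> w [:- x, 1:]"
      using linear_val_ge[OF w aw] val_diff_commute[OF v] by metis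
  next
    fix x assume "Fin \<gamma> \<le> w [:- x, 1:]"
    thus "Fin \<gamma> \<le> v (x - a)"
      by (rule linear_val_diff_ge[OF w _ aw])
  qed
qed

section \<open>Key polynomials and optimal balls\<close>

theorem theorem4p7:
  fixes \<iota> :: "'k::field \<Rightarrow> 'a::alg_closed_field"
    and v :: "'a \<Rightarrow> 'l::divisible_linordered_ab_group_add extended"
    and \<mu> :: "'k poly \<Rightarrow> 'l extended"
    and \<mu>bar :: "'a poly \<Rightarrow> 'l extended"
    and a :: 'a and \<delta> :: 'l
    and I :: "'i::linorder set" and A :: "'i \<Rightarrow> 'a" and D :: "'i \<Rightarrow> 'l"
    and \<B>opt :: "'a set set"
  assumes closure: "is_alg_closure \<iota>"
    and v: "is_valuation v"
    and \<mu>: "\<mu> \<in> poly_valuations (v \<circ> \<iota>)"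
    and \<mu>bar: "\<mu>bar \<in> poly_valuations v" "restrict_val \<iota> \<mu>bar = \<mu>"
    and chain: "presents \<iota> v \<mu> \<mu>bar a \<delta> I A D"
    and \<B>opt: "\<B>opt = optimal_balls \<iota> v \<mu> (ball_chain \<iota> v \<mu> a \<delta> I A D)"
  shows "abstract_key_polys \<mu> = (\<Union>B\<in>\<B>opt. min_poly \<iota> ` Opt \<iota> v \<mu> B) \<and>
         disjoint_family_on (\<lambda>B. min_poly \<iota> ` Opt \<iota> v \<mu> B) \<B>opt"
proof -
  interpret algebraic_closure \<iota> by unfold_locales (rule closure)
  have w: "is_valuation \<mu>bar" using \<mu>bar(1) by (simp add: poly_valuations_def)
  obtain T where T: "ball_basis v \<mu>bar T"
    and BT: "ball_chain \<iota> v \<mu> a \<delta> I A D = {B \<in> all_balls v. \<exists>(a, \<delta>)\<in>T. vball v a \<delta> \<subseteq> B}"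
    using presents_ball_basis[OF v chain] .
  define E where "E \<gamma> = {x. Fin \<gamma> \<le> \<mu>bar [:- x, 1:]}" for \<gamma>
  have root_eps: "\<mu>bar [:- c, 1:] \<le> Fin (eps \<mu> f)"
    if "Polynomial.degree f > 0" "poly (map_poly \<iota> f) c = 0" for f c
    using eps_alg_closed(1)[OF w, of "map_poly \<iota> f" c] that eps_restrict_val[of \<mu>bar f] \<mu>bar(2)
    by simp
  have ex_root: "\<exists>c. poly (map_poly \<iota> f) c = 0 \<and> \<mu>bar [:- c, 1:] = Fin (eps \<mu> f)"
    if "Polynomial.degree f > 0" for f
    using eps_alg_closed(2)[OF w, of "map_poly \<iota> f"] that eps_restrict_val[of \<mu>bar f] \<mu>bar(2)
    by simp
  \<comment> \<open>The minimal polynomial of a witness of optimality has a root, possibly another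
    one, where the value is exactly \<open>\<gamma>\<close>.\<close>
  have optE: "B = E \<gamma>" "\<exists>c. \<mu>bar [:- c, 1:] = Fin \<gamma>" if B: "B \<in> \<B>opt" "optimal_radius \<iota> v \<mu> B \<gamma>" for B \<gamma>
  proof -
    show c: "\<exists>c. \<mu>bar [:- c, 1:] = Fin \<gamma>"
      using B(2) ex_root[OF degree_min_poly_pos] by (auto simp: optimal_radius_def)
    show "B = E \<gamma>"
      using chain_ball_eq[OF v \<mu>bar(1) T, of B _ \<gamma>] B c
      unfolding \<B>opt optimal_balls_def BT optimal_radius_def E_def by blast
  qed
  have radius: "(THE \<gamma>. optimal_radius \<iota> v \<mu> B \<gamma>) = \<gamma>" if B: "B \<in> \<B>opt" "optimal_radius \<iota> v \<mu> B \<gamma>" for B \<gamma>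
  proof (rule the_equality[where P = "optimal_radius \<iota> v \<mu> B", OF B(2)])
    fix \<gamma>' assume \<gamma>': "optimal_radius \<iota> v \<mu> B \<gamma>'"
    obtain c c' where "\<mu>bar [:- c, 1:] = Fin \<gamma>" "\<mu>bar [:- c', 1:] = Fin \<gamma>'"
      using optE(2)[OF B] optE(2)[OF B(1) \<gamma>'] by blast
    moreover have "E \<gamma> = E \<gamma>'"
      using optE(1)[OF B] optE(1)[OF B(1) \<gamma>'] by simp
    \<comment> \<open>The point \<open>c\<close> lies in \<open>E \<gamma>\<close>, hence in
      \<open>E \<gamma>'\<close>, and its value is exactly \<open>\<gamma>\<close>; the other
      inequality is symmetric.\<close>
    ultimately have "\<gamma>' \<le> \<gamma>" "\<gamma> \<le> \<gamma>'"
      unfolding E_def by (metis less_eq_extended.simps(1) mem_Collect_eq order_refl)+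
    thus "\<gamma>' = \<gamma>" by simp
  qed
  \<comment> \<open>The ball can be read off from the minimal polynomial alone; disjointness rests
    on this.\<close>
  have OptD: "B = E (eps \<mu> (min_poly \<iota> c))" "c \<in> MinK \<iota> B" if B: "B \<in> \<B>opt" "c \<in> Opt \<iota> v \<mu> B" for B c
  proof -
    obtain \<gamma> where \<gamma>: "optimal_radius \<iota> v \<mu> B \<gamma>"
      using B(1) unfolding \<B>opt optimal_balls_def by blast
    show "B = E (eps \<mu> (min_poly \<iota> c))" "c \<in> MinK \<iota> B"
      using B(2) radius[OF B(1) \<gamma>] optE(1)[OF B(1) \<gamma>] by (auto simp: Opt_def)
  qed
  have "min_poly \<iota> c \<in> abstract_key_polys \<mu>" if B: "B \<in> \<B>opt" "c \<in> Opt \<iota> v \<mu> B" for B c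
  proof -
    have "eps \<mu> f < eps \<mu> (min_poly \<iota> c)"
      if f: "Polynomial.degree f > 0" "Polynomial.degree f < Polynomial.degree (min_poly \<iota> c)" for f
    proof (rule ccontr)
      assume "\<not> eps \<mu> f < eps \<mu> (min_poly \<iota> c)"
      \<comment> \<open>A counterexample \<open>f\<close> would have a root in \<open>B\<close>
        whose degree is below the minimum over \<open>B\<close>.\<close>
      moreover obtain b where b: "poly (map_poly \<iota> f) b = 0" "\<mu>bar [:- b, 1:] = Fin (eps \<mu> f)"
        using ex_root[OF f(1)] by blast
      ultimately have "b \<in> B"
        using OptD(1)[OF B] by (simp add: E_def)
      hence "degK \<iota> c \<le> degK \<iota> b"
        using OptD(2)[OF B] by (simp add: MinK_iff)
      also have "\<dots> \<le> Polynomial.degree f"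
        unfolding degK_def using b(1) f(1) by (intro degree_min_poly_le) auto
      finally show False using f(2) by (simp add: degK_def)
    qed
    thus ?thesis
      by (simp add: abstract_key_polys_def lead_coeff_min_poly degree_min_poly_pos)
  qed
  moreover have "\<exists>B\<in>\<B>opt. \<exists>c\<in>Opt \<iota> v \<mu> B. Q = min_poly \<iota> c" if Q: "Q \<in> abstract_key_polys \<mu>" for Q
  proof -
    define \<gamma> where "\<gamma> = eps \<mu> Q"
    have Q1: "Polynomial.lead_coeff Q = 1" and Q0: "Polynomial.degree Q > 0"
      and key: "\<And>f. Polynomial.degree f > 0 \<Longrightarrow> \<gamma> \<le> eps \<mu> f \<Longrightarrow> Polynomial.degree Q \<le> Polynomial.degree f"
      using Q unfolding abstract_key_polys_def \<gamma>_def by (auto simp: not_less[symmetric])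
    obtain c where c: "poly (map_poly \<iota> Q) c = 0" "\<mu>bar [:- c, 1:] = Fin \<gamma>"
      using ex_root[OF Q0] unfolding \<gamma>_def by blast
    \<comment> \<open>The center is a root of \<open>Q\<close> at which \<open>eps\<close> is
      attained, which places this ball in the chain.\<close>
    define B where "B = vball v c \<gamma>"
    \<comment> \<open>Points of \<open>B\<close> have minimal polynomials with \<open>eps\<close> at
      least \<open>\<gamma>\<close>, so the contrapositive of the key property bounds their
      degrees.\<close>
    have degB: "Polynomial.degree Q \<le> degK \<iota> b" if "b \<in> B" for b
    proof -
      have "Fin \<gamma> \<le> \<mu>bar [:- b, 1:]"
        using that c(2) val_diff_commute[OF v, of c b] unfolding B_def vball_def
        by (intro linear_val_ge[OF \<mu>bar(1), of \<gamma> c b]) simp_all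
      also have "\<dots> \<le> Fin (eps \<mu> (min_poly \<iota> b))"
        by (rule root_eps[OF degree_min_poly_pos root_min_poly])
      finally show ?thesis
        unfolding degK_def by (intro key degree_min_poly_pos) simp
    qed
    have cB: "c \<in> B" unfolding B_def by (rule center_in_vball[OF v])
    have mp: "min_poly \<iota> c = Q"
      using degB[OF cB] by (intro min_poly_eqI Q1 c(1)) (simp add: degK_def)
    have cM: "c \<in> MinK \<iota> B"
      using cB degB mp by (simp add: MinK_iff degK_def)
    have rad: "optimal_radius \<iota> v \<mu> B \<gamma>"
      unfolding optimal_radius_def using cM mp by (auto simp: B_def \<gamma>_def)
    have "B \<in> \<B>opt"
      unfolding \<B>opt optimal_balls_def BT
      using rad vball_in_chain[OF v T c(2)] by (auto simp: all_balls_def B_def)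
    moreover have "c \<in> Opt \<iota> v \<mu> B"
      unfolding Opt_def using cM mp radius[OF calculation rad] by (simp add: \<gamma>_def)
    ultimately show ?thesis using mp by blast
  qed
  moreover have "disjoint_family_on (\<lambda>B. min_poly \<iota> ` Opt \<iota> v \<mu> B) \<B>opt"
    unfolding disjoint_family_on_def
  proof (intro ballI impI equals0I)
    fix B B' Q
    assume B: "B \<in> \<B>opt" "B' \<in> \<B>opt" "B \<noteq> B'"
      and "Q \<in> min_poly \<iota> ` Opt \<iota> v \<mu> B \<inter> min_poly \<iota> ` Opt \<iota> v \<mu> B'"
    then obtain c c' where "c \<in> Opt \<iota> v \<mu> B" "c' \<in> Opt \<iota> v \<mu> B'" "min_poly \<iota> c = min_poly \<iota> c'"
      by auto
    thus False
      using OptD(1)[OF B(1)] OptD(1)[OF B(2)] B(3) by metis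
  qed
  ultimately show ?thesis by blast
qed

end
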